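(* Let $n \ge 1$ and $q \geq 4$ be integers. Then the distance-$2$ chromatic number of the Lee graph $G(n,q)$ satisfies $\chi_2(G(n,q)) \geq 2n+1$ if $-1$ is an adjacency eigenvalue of $G(n,q)$, $\chi_2(G(n,q)) \geq 2n+2$ if $-1$ is not an adjacency eigenvalue of $G(n,q)$, and $\chi_2(G(n,q)) \ge 2n+3$ if $n = 1$ and $q = 5$.
   Context: The Lee graph $G(n,q)$ is the $n$-fold Cartesian product of the cycle $C_q$ with itself; its adjacency eigenvalues are $\sum_{j=1}^n 2\cos(2\pi l_j/q)$ for $l_1,\ldots,l_n\in[1,q]$. $\chi_2(G)$ is the minimum number of colors in a vertex coloring in which any two distinct vertices at distance at most $2$ receive distinct colors. *)

theory Defs
  imports "Graph_Theory.Graph_Theory" "Jordan_Normal_Form.Char_Poly"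
begin

text \<open>Undirected simple graphs are represented as symmetric loop-free digraphs
  (locale \<^locale>\<open>pair_graph\<close>).\<close>

definition cycle_graph :: "nat \<Rightarrow> nat pair_pre_digraph" where
  "cycle_graph q =
     \<lparr> pverts = {..<q},
       parcs = {(u, v). u < q \<and> v < q \<and> (v = Suc u mod q \<or> u = Suc v mod q)} \<rparr>"

text \<open>The vertices of the \<open>n\<close>-fold Cartesian product of \<open>G\<close> with itself are the
  \<open>n\<close>-tuples of vertices of \<open>G\<close>, encoded as lists.\<close>

definition cartesian_power :: "'a pair_pre_digraph \<Rightarrow> nat \<Rightarrow> 'a list pair_pre_digraph" where
  "cartesian_power G n =
     (let V = {xs. length xs = n \<and> set xs \<subseteq> pverts G} in
     \<lparr> pverts = V,
       parcs = {(xs, ys). xs \<in> V \<and> ys \<in> V \<and>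
         (\<exists>i<n. (xs ! i, ys ! i) \<in> parcs G \<and> (\<forall>j<n. j \<noteq> i \<longrightarrow> xs ! j = ys ! j))} \<rparr>)"

definition lee_graph :: "nat \<Rightarrow> nat \<Rightarrow> nat list pair_pre_digraph" where
  "lee_graph n q = cartesian_power (cycle_graph q) n"

definition adjacency_mat :: "'a pair_pre_digraph \<Rightarrow> 'a list \<Rightarrow> real mat" where
  "adjacency_mat G vs =
     mat (length vs) (length vs) (\<lambda>(i, j). if (vs ! i, vs ! j) \<in> parcs G then 1 else 0)"

text \<open>Adjacency matrices for different enumerations \<open>vs\<close> of the vertices are similar, so
  the choice of \<open>vs\<close> is immaterial.\<close>

definition adjacency_eigenvalue :: "'a pair_pre_digraph \<Rightarrow> real \<Rightarrow> bool" where
  "adjacency_eigenvalue G k \<longleftrightarrow>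
     (\<exists>vs. distinct vs \<and> set vs = pverts G \<and> eigenvalue (adjacency_mat G vs) k)"

text \<open>Every arc has cost 1, so this is the least number of edges of a walk from \<open>u\<close> to \<open>v\<close>,
  and \<open>\<infinity>\<close> if there is none.\<close>

definition graph_dist :: "'a pair_pre_digraph \<Rightarrow> 'a \<Rightarrow> 'a \<Rightarrow> ereal" where
  "graph_dist G u v = wf_digraph.\<mu> (with_proj G) (\<lambda>_. 1) u v"

definition distance_coloring :: "nat \<Rightarrow> 'a pair_pre_digraph \<Rightarrow> ('a \<Rightarrow> nat) \<Rightarrow> bool" where
  "distance_coloring t G c \<longleftrightarrow>
     (\<forall>u \<in> pverts G. \<forall>v \<in> pverts G. u \<noteq> v \<and> graph_dist G u v \<le> ereal (real t) \<longrightarrow> c u \<noteq> c v)"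

definition distance_chromatic_number :: "nat \<Rightarrow> 'a pair_pre_digraph \<Rightarrow> nat" where
  "distance_chromatic_number t G =
     (LEAST k. \<exists>c. distance_coloring t G c \<and> c ` pverts G \<subseteq> {..<k})"

text \<open>On a finite graph colorings exist, so the minimum is attained.\<close>

lemma distance_chromatic_number_attained:
  assumes "finite (pverts G)"
  shows "\<exists>c. distance_coloring t G c \<and> c ` pverts G \<subseteq> {..<distance_chromatic_number t G}"
proof -
  obtain c :: "'a \<Rightarrow> nat" where c: "bij_betw c (pverts G) {0..<card (pverts G)}"
    using ex_bij_betw_finite_nat[OF assms] by blast
  then have "distance_coloring t G c \<and> c ` pverts G \<subseteq> {..<card (pverts G)}"
    by (auto simp: distance_coloring_def bij_betw_def inj_on_def)
  then show ?thesis
    unfolding distance_chromatic_number_def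
    by (intro LeastI[where P = "\<lambda>k. \<exists>c. distance_coloring t G c \<and> c ` pverts G \<subseteq> {..<k}"]) blast
qed

lemma pair_graphI:
  assumes "finite (pverts G)"
    and "parcs G \<subseteq> pverts G \<times> pverts G"
    and "\<And>u v. (u, v) \<in> parcs G \<Longrightarrow> (v, u) \<in> parcs G"
    and "\<And>u. (u, u) \<notin> parcs G"
  shows "pair_graph G"
proof
  show "finite (parcs G)"
    using assms(1,2) by (meson finite_SigmaI finite_subset)
  show "symmetric (with_proj G)"
    using assms(3) by (simp add: symmetric_def sym_def)
  show "fst e \<noteq> snd e" if "e \<in> parcs G" for e
    using assms(4) that by (metis prod.collapse)
qed (use assms(1,2) in auto)

lemma pair_graph_cycle_graph:
  assumes "q \<ge> 2"
  shows "pair_graph (cycle_graph q)"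
proof -
  have "Suc u mod q \<noteq> u" if "u < q" for u
    using assms that by (cases "Suc u = q") auto
  then show ?thesis
    by (intro pair_graphI) (auto simp: cycle_graph_def dest: sym)
qed

lemma pair_graph_cartesian_power:
  assumes "pair_graph G"
  shows "pair_graph (cartesian_power G n)"
proof -
  interpret pair_graph G by fact
  have fin: "finite (pverts (cartesian_power G n))"
    using finite_lists_length_eq[OF pair_finite_verts, of n]
    by (simp add: cartesian_power_def Let_def conj_commute)
  have sym: "(v, u) \<in> parcs G" if "(u, v) \<in> parcs G" for u v
    using that pair_sym_arcs by (auto simp: symmetric_def sym_def)
  have loop: "(u, u) \<notin> parcs G" for u
    using pair_no_loops by fastforce
  show ?thesis
  proof (rule pair_graphI[OF fin])
    show "(ys, xs) \<in> parcs (cartesian_power G n)"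
      if "(xs, ys) \<in> parcs (cartesian_power G n)" for xs ys
      using that by (simp add: cartesian_power_def Let_def) (metis sym)
  qed (auto simp: cartesian_power_def Let_def loop)
qed

lemma pair_graph_lee_graph: "q \<ge> 2 \<Longrightarrow> pair_graph (lee_graph n q)"
  by (simp add: lee_graph_def pair_graph_cartesian_power pair_graph_cycle_graph)

end

theory Submission
  imports Defs
begin

text \<open>
  Closed neighborhoods have diameter at most 2, so in the \<open>2n\<close>-regular graph \<open>G(n,q)\<close> a
  distance-2 coloring uses at least \<open>2n + 1\<close> colors. If it uses exactly \<open>2n + 1\<close> colors, then
  every closed neighborhood meets each color class exactly once: \<open>A + I\<close> maps the indicator
  vector of each color class to the all-ones vector. The difference of two of these
  indicators is then an eigenvector of \<open>A\<close> for the eigenvalue \<open>-1\<close>.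
  In \<open>G(1,5)\<close> all five vertices are at pairwise distance at most 2.
\<close>

section \<open>Distance-2 colorings of regular graphs\<close>

text \<open>The distance \<open>\<mu>\<close> is an infimum over walk costs, so exhibiting one walk
  bounds it. Upper bounds suffice throughout, because a coloring restricts only pairs of vertices
  that are close.\<close>

lemma (in pair_wf_digraph) graph_dist_le_1:
  assumes "(u, v) \<in> parcs G"
  shows "graph_dist G u v \<le> 1"
proof -
  have "awalk u [(u, v)] v"
    using assms by (simp add: awalk_simps wellformed')
  from min_cost_le_walk_cost[OF this, of "\<lambda>_. 1"] show ?thesis
    by (simp add: graph_dist_def one_ereal_def)
qed

lemma (in pair_wf_digraph) graph_dist_le_2:
  assumes "(u, v) \<in> parcs G" and "(v, w) \<in> parcs G"
  shows "graph_dist G u w \<le> 2"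
proof -
  have "awalk u [(u, v), (v, w)] w"
    using assms by (simp add: awalk_simps wellformed')
  from min_cost_le_walk_cost[OF this, of "\<lambda>_. 1"] show ?thesis
    by (simp add: graph_dist_def)
qed

lemma (in pair_graph) parcs_commute: "(u, v) \<in> parcs G \<longleftrightarrow> (v, u) \<in> parcs G"
  using pair_sym_arcs by (auto simp: symmetric_def sym_def)

lemma (in pair_graph) no_loop: "(u, u) \<notin> parcs G"
  using pair_no_loops by fastforce

text \<open>Two neighbors of \<open>w\<close> are joined by a walk of length 2 through
  \<open>w\<close>, and \<open>w\<close> is adjacent to each of them. All later use of the coloring
  condition goes through this fact.\<close>

lemma (in pair_graph) distance_coloring_inj_on_closed_nbhd:
  assumes "distance_coloring 2 G c" and "w \<in> pverts G"
  shows "inj_on c (insert w (parcs G `` {w}))"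
proof (rule inj_onI, rule ccontr)
  fix u v
  assume uv: "u \<in> insert w (parcs G `` {w})" "v \<in> insert w (parcs G `` {w})"
    and eq: "c u = c v" and "u \<noteq> v"
  have "graph_dist G u v \<le> 2"
  proof (cases "u = w \<or> v = w")
    case True
    then have "graph_dist G u v \<le> 1"
      using uv \<open>u \<noteq> v\<close> by (auto intro: graph_dist_le_1 parcs_commute[THEN iffD1])
    then show ?thesis
      by (rule order_trans) simp
  next
    case False
    then show ?thesis
      using uv graph_dist_le_2[of u w v] by (auto intro: parcs_commute[THEN iffD1])
  qed
  then show False
    using assms uv eq \<open>u \<noteq> v\<close> by (auto simp: distance_coloring_def wellformed')
qed

lemma (in pair_graph) closed_nbhd:
  assumes "w \<in> pverts G"
  shows "insert w (parcs G `` {w}) \<subseteq> pverts G"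
    and "finite (insert w (parcs G `` {w}))"
    and "card (insert w (parcs G `` {w})) = Suc (card (parcs G `` {w}))"
proof -
  show sub: "insert w (parcs G `` {w}) \<subseteq> pverts G"
    using assms by (auto simp: wellformed')
  show fin: "finite (insert w (parcs G `` {w}))"
    using finite_subset[OF sub pair_finite_verts] .
  show "card (insert w (parcs G `` {w})) = Suc (card (parcs G `` {w}))"
    using fin by (auto simp: no_loop)
qed

lemma (in pair_graph) distance_2_coloring_card_le:
  assumes "distance_coloring 2 G c" and "c ` pverts G \<subseteq> {..<k}" and "w \<in> pverts G"
  shows "Suc (card (parcs G `` {w})) \<le> k"
proof -
  have "c ` insert w (parcs G `` {w}) \<subseteq> {..<k}"
    using closed_nbhd(1)[OF assms(3)] assms(2) by blast
  then have "card (insert w (parcs G `` {w})) \<le> card {..<k}"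
    using distance_coloring_inj_on_closed_nbhd[OF assms(1,3)] by (intro card_inj_on_le) auto
  then show ?thesis
    by (simp only: closed_nbhd(3)[OF assms(3)] card_lessThan)
qed

text \<open>The matrix acts as the operator summing a function over neighbors. This lets
  eigenvectors be handled as functions on vertices, without reference to the enumeration
  \<open>vs\<close>.\<close>

lemma adjacency_mat_mult_vec:
  assumes "distinct vs" and "set vs = pverts G" and "i < length vs"
    and "parcs G `` {vs ! i} \<subseteq> pverts G"
  shows "(adjacency_mat G vs *\<^sub>v vec (length vs) (\<lambda>j. f (vs ! j))) $ i
    = (\<Sum>v\<in>parcs G `` {vs ! i}. f v)"
proof -
  have "(adjacency_mat G vs *\<^sub>v vec (length vs) (\<lambda>j. f (vs ! j))) $ i
      = (\<Sum>j<length vs. (if (vs ! i, vs ! j) \<in> parcs G then 1 else 0) * f (vs ! j))"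
    using assms(3)
    by (auto simp: adjacency_mat_def scalar_prod_def lessThan_atLeast0 intro!: sum.cong)
  also have "\<dots> = (\<Sum>v\<in>pverts G. (if (vs ! i, v) \<in> parcs G then 1 else 0) * f v)"
    using bij_betw_nth[OF assms(1) refl assms(2)[symmetric]]
    by (rule sum.reindex_bij_betw)
  also have "\<dots> = (\<Sum>v\<in>parcs G `` {vs ! i}. f v)"
    using assms(2,4) by (intro sum.mono_neutral_cong_right) (auto simp flip: assms(2))
  finally show ?thesis .
qed

text \<open>For any enumeration of the vertices, the list of values of \<open>f\<close> is an
  eigenvector; the vertex \<open>u\<close> with \<open>f u \<noteq> 0\<close> keeps it from being
  the zero vector.\<close>

lemma adjacency_eigenvalueI:
  assumes "finite (pverts G)"
    and "\<And>u. u \<in> pverts G \<Longrightarrow> parcs G `` {u} \<subseteq> pverts G"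
    and "\<And>u. u \<in> pverts G \<Longrightarrow> (\<Sum>v\<in>parcs G `` {u}. f v) = k * f u"
    and "u \<in> pverts G" and "f u \<noteq> 0"
  shows "adjacency_eigenvalue G k"
proof -
  obtain vs where vs: "set vs = pverts G" "distinct vs"
    using finite_distinct_list[OF assms(1)] by blast
  define x where "x = vec (length vs) (\<lambda>j. f (vs ! j))"
  obtain i where i: "i < length vs" "vs ! i = u"
    using assms(4) vs(1) by (metis in_set_conv_nth)
  have "x \<noteq> 0\<^sub>v (length vs)"
  proof
    assume "x = 0\<^sub>v (length vs)"
    then have "x $ i = 0"
      using i(1) by simp
    then show False
      using i assms(5) by (simp add: x_def)
  qed
  moreover have "adjacency_mat G vs *\<^sub>v x = k \<cdot>\<^sub>v x"
  proof (rule eq_vecI)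
    fix j assume "j < dim_vec (k \<cdot>\<^sub>v x)"
    then have j: "j < length vs"
      by (simp add: x_def)
    then have "vs ! j \<in> pverts G"
      using vs(1) nth_mem by blast
    then show "(adjacency_mat G vs *\<^sub>v x) $ j = (k \<cdot>\<^sub>v x) $ j"
      using adjacency_mat_mult_vec[OF vs(2,1) j, of f] assms(2,3) j
      by (simp add: x_def)
  qed (simp add: x_def adjacency_mat_def)
  ultimately have "eigenvector (adjacency_mat G vs) x k"
    by (simp add: eigenvector_def adjacency_mat_def x_def)
  then show ?thesis
    using vs by (auto simp: adjacency_eigenvalue_def eigenvalue_def)
qed

lemma (in pair_graph) distance_2_coloring_perfect_imp_eigenvalue:
  assumes "distance_coloring 2 G c" and "c ` pverts G \<subseteq> {..<Suc d}"
    and "d > 0" and "pverts G \<noteq> {}"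
    and deg: "\<And>u. u \<in> pverts G \<Longrightarrow> card (parcs G `` {u}) = d"
  shows "adjacency_eigenvalue G (-1)"
proof -
  let ?N = "\<lambda>u. insert u (parcs G `` {u})"
  have bij: "bij_betw c (?N u) {..<Suc d}" if "u \<in> pverts G" for u
  proof -
    have inj: "inj_on c (?N u)"
      using assms(1) that by (rule distance_coloring_inj_on_closed_nbhd)
    moreover have "c ` ?N u \<subseteq> {..<Suc d}"
      using closed_nbhd(1)[OF that] assms(2) by blast
    \<comment> \<open>Injectivity gives the image \<open>d + 1\<close> elements, as many as there
      are colors, so every color occurs.\<close>
    then have "c ` ?N u = {..<Suc d}"
      by (intro card_subset_eq)
        (simp_all only: card_image[OF inj] closed_nbhd(3)[OF that] deg[OF that] card_lessThan
          finite_lessThan)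
    ultimately show ?thesis
      by (simp add: bij_betw_def)
  qed
  \<comment> \<open>The eigenvector will be \<open>g\<close> composed with \<open>c\<close>, the
    indicator of color class 0 minus that of color class 1. Both colors are available because
    \<open>d > 0\<close>.\<close>
  define g :: "nat \<Rightarrow> real" where "g i = of_bool (i = 0) - of_bool (i = 1)" for i
  have sum_g: "(\<Sum>i<Suc d. g i) = 0"
  proof -
    have "(\<Sum>i<Suc d. g i) = (\<Sum>i\<in>{0, 1}. g i)"
      using \<open>d > 0\<close> by (intro sum.mono_neutral_right) (auto simp: g_def)
    then show ?thesis
      by (simp add: g_def)
  qed
  have nbhd: "(\<Sum>v\<in>parcs G `` {u}. g (c v)) = - 1 * g (c u)" if "u \<in> pverts G" for u
  proof -
    \<comment> \<open>Along the bijection \<open>c\<close>, the sum over a closed neighborhood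
      becomes the sum of \<open>g\<close> over all colors.\<close>
    have "(\<Sum>v\<in>?N u. g (c v)) = 0"
      using sum.reindex_bij_betw[OF bij[OF that], of g] sum_g by simp
    moreover have "(\<Sum>v\<in>?N u. g (c v)) = g (c u) + (\<Sum>v\<in>parcs G `` {u}. g (c v))"
      using closed_nbhd(2)[OF that] by (intro sum.insert) (auto simp: no_loop)
    ultimately show ?thesis
      by simp
  qed
  obtain w where w: "w \<in> pverts G"
    using assms(4) by blast
  \<comment> \<open>Color 0 is actually used, so the eigenvector does not vanish.\<close>
  have "0 \<in> c ` ?N w"
    using bij[OF w] by (simp add: bij_betw_def)
  then obtain u where "u \<in> ?N w" "c u = 0"
    by force
  then have u: "u \<in> pverts G" "g (c u) \<noteq> 0"
    using closed_nbhd(1)[OF w] by (auto simp: g_def)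
  show ?thesis
    using adjacency_eigenvalueI[OF pair_finite_verts _ nbhd u] wellformed'(2) by blast
qed

section \<open>The Lee graph\<close>

text \<open>The neighbors are the cyclic successor and predecessor of \<open>u\<close>; these differ
  once \<open>q \<ge> 3\<close>, whereas for \<open>q = 2\<close> they coincide.\<close>

lemma card_nbhd_cycle_graph:
  assumes "q \<ge> 3" and "u < q"
  shows "card (parcs (cycle_graph q) `` {u}) = 2"
proof -
  have "parcs (cycle_graph q) `` {u} = {Suc u mod q, if u = 0 then q - 1 else u - 1}"
  proof (intro equalityI subsetI)
    fix v assume "v \<in> parcs (cycle_graph q) `` {u}"
    then have "v < q" "v = Suc u mod q \<or> u = Suc v mod q"
      by (auto simp: cycle_graph_def)
    then show "v \<in> {Suc u mod q, if u = 0 then q - 1 else u - 1}"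
      by (cases "Suc v = q") auto
  qed (use assms in \<open>auto simp: cycle_graph_def split: if_splits\<close>)
  moreover have "Suc u mod q \<noteq> (if u = 0 then q - 1 else u - 1)"
    using assms by (cases "Suc u = q") auto
  ultimately show ?thesis
    by simp
qed

text \<open>A neighbor of \<open>xs\<close> corresponds to a unique pair of a coordinate
  \<open>i\<close> and a neighbor \<open>y\<close> of \<open>xs ! i\<close> in \<open>G\<close>,
  which gives \<open>n\<close> times \<open>d\<close> choices.\<close>

lemma card_nbhd_cartesian_power:
  assumes "pair_graph G" and "xs \<in> pverts (cartesian_power G n)"
    and deg: "\<And>u. u \<in> pverts G \<Longrightarrow> card (parcs G `` {u}) = d"
  shows "card (parcs (cartesian_power G n) `` {xs}) = n * d"
proof -
  interpret pair_graph G by fact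
  have xs: "length xs = n" "set xs \<subseteq> pverts G"
    using assms(2) by (auto simp: cartesian_power_def Let_def)
  then have mem: "xs ! i \<in> pverts G" if "i < n" for i
    using that nth_mem by blast
  let ?S = "SIGMA i:{..<n}. parcs G `` {xs ! i}"
  let ?f = "\<lambda>(i, y). xs[i := y]"
  have "parcs (cartesian_power G n) `` {xs} = ?f ` ?S"
  proof (intro equalityI subsetI)
    fix ys assume "ys \<in> parcs (cartesian_power G n) `` {xs}"
    then obtain i where i: "i < n" "(xs ! i, ys ! i) \<in> parcs G"
      "\<And>j. j < n \<Longrightarrow> j \<noteq> i \<Longrightarrow> xs ! j = ys ! j" and len: "length ys = n"
      by (auto simp: cartesian_power_def Let_def)
    have "ys = xs[i := ys ! i]"
      using i len xs(1) by (intro nth_equalityI) (auto simp: nth_list_update)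
    then show "ys \<in> ?f ` ?S"
      using i(1,2) by force
  next
    fix ys assume "ys \<in> ?f ` ?S"
    then obtain i y where iy: "i < n" "(xs ! i, y) \<in> parcs G" "ys = xs[i := y]"
      by auto
    then have "set ys \<subseteq> pverts G"
      using xs(2) set_update_subset_insert[of xs i y] wellformed'(2) by blast
    then show "ys \<in> parcs (cartesian_power G n) `` {xs}"
      using iy xs by (auto simp: cartesian_power_def Let_def intro!: exI[of _ i])
  qed
  moreover have "inj_on ?f ?S"
  proof (rule inj_onI, clarify)
    fix i y j z
    assume *: "i < n" "(xs ! i, y) \<in> parcs G" "j < n" "(xs ! j, z) \<in> parcs G"
      "xs[i := y] = xs[j := z]"
    \<comment> \<open>Since \<open>G\<close> has no loops, the update really changes coordinate
      \<open>i\<close>, so \<open>i\<close> can be recovered from the updated list.\<close>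
    have "y \<noteq> xs ! i"
      using *(2) no_loop by auto
    moreover have "y = xs[j := z] ! i"
      using *(1,5) xs(1) by (metis nth_list_update_eq)
    ultimately have "i = j"
      by (metis nth_list_update_neq)
    then show "i = j \<and> y = z"
      using \<open>y = xs[j := z] ! i\<close> *(3) xs(1) by simp
  qed
  moreover have "card ?S = n * d"
    using mem deg closed_nbhd(2) by (subst card_SigmaI) auto
  ultimately show ?thesis
    by (simp add: card_image)
qed

lemma pverts_lee_graph: "pverts (lee_graph n q) = {xs. length xs = n \<and> set xs \<subseteq> {..<q}}"
  by (simp add: lee_graph_def cartesian_power_def cycle_graph_def)

lemma card_nbhd_lee_graph:
  assumes "q \<ge> 3" and "xs \<in> pverts (lee_graph n q)"
  shows "card (parcs (lee_graph n q) `` {xs}) = 2 * n"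
  using card_nbhd_cartesian_power[OF pair_graph_cycle_graph, of q xs n 2] assms
    card_nbhd_cycle_graph[OF assms(1)]
  by (simp add: lee_graph_def) (simp add: cycle_graph_def)

text \<open>The 5-cycle has diameter 2; this is the source of the stronger bound in the exceptional
  case.\<close>

lemma distance_2_coloring_lee_graph_1_5:
  assumes "distance_coloring 2 (lee_graph 1 5) c"
  shows "inj_on c (pverts (lee_graph 1 5))"
proof -
  interpret pair_graph "lee_graph 1 5"
    by (rule pair_graph_lee_graph) simp
  have verts: "pverts (lee_graph 1 5) = (\<lambda>u. [u]) ` {..<5}"
    by (force simp: pverts_lee_graph length_Suc_conv)
  have arcs: "([u], [v]) \<in> parcs (lee_graph 1 5) \<longleftrightarrow>
      u < 5 \<and> v < 5 \<and> (v = Suc u mod 5 \<or> u = Suc v mod 5)" for u v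
    by (auto simp: lee_graph_def cartesian_power_def cycle_graph_def)
  \<comment> \<open>Instead of bounding distances, a closed neighborhood containing both vertices is
    found, so that injectivity on closed neighborhoods applies. The 25 pairs are checked one by
    one.\<close>
  have near: "\<exists>w<5. {[u], [v]} \<subseteq> insert [w] (parcs (lee_graph 1 5) `` {[w]})"
    if "u < 5" "v < 5" for u v
  proof -
    have "u \<in> {0, 1, 2, 3, 4}" "v \<in> {0, 1, 2, 3, 4}"
      using that by auto
    moreover have "(\<exists>w<5. P w) \<longleftrightarrow> P 0 \<or> P 1 \<or> P 2 \<or> P 3 \<or> P (4::nat)" for P
      by (auto simp: numeral_eq_Suc less_Suc_eq)
    ultimately show ?thesis
      by (elim insertE emptyE) (simp_all add: arcs del: One_nat_def)
  qed
  show ?thesis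
  proof (rule inj_onI)
    fix xs ys
    assume xy: "xs \<in> pverts (lee_graph 1 5)" "ys \<in> pverts (lee_graph 1 5)" "c xs = c ys"
    then obtain u v where uv: "u < 5" "v < 5" "xs = [u]" "ys = [v]"
      unfolding verts by blast
    then obtain w where "w < 5"
      "{xs, ys} \<subseteq> insert [w] (parcs (lee_graph 1 5) `` {[w]})"
      using near by blast
    moreover from this have "inj_on c (insert [w] (parcs (lee_graph 1 5) `` {[w]}))"
      by (intro distance_coloring_inj_on_closed_nbhd[OF assms]) (simp add: pverts_lee_graph)
    ultimately show "xs = ys"
      using xy(3) by (meson inj_onD insert_subset)
  qed
qed

theorem theorem4p18:
  fixes n q :: nat
  assumes "n \<ge> 1" and "q \<ge> 4"
  shows "(adjacency_eigenvalue (lee_graph n q) (-1) \<longrightarrow>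
           distance_chromatic_number 2 (lee_graph n q) \<ge> 2 * n + 1) \<and>
         (\<not> adjacency_eigenvalue (lee_graph n q) (-1) \<longrightarrow>
           distance_chromatic_number 2 (lee_graph n q) \<ge> 2 * n + 2) \<and>
         (n = 1 \<and> q = 5 \<longrightarrow>
           distance_chromatic_number 2 (lee_graph n q) \<ge> 2 * n + 3)"
proof -
  let ?G = "lee_graph n q"
  let ?k = "distance_chromatic_number 2 ?G"
  interpret pair_graph ?G
    using assms(2) by (intro pair_graph_lee_graph) simp
  obtain c where c: "distance_coloring 2 ?G c" "c ` pverts ?G \<subseteq> {..<?k}"
    using distance_chromatic_number_attained[OF pair_finite_verts] by blast
  have deg: "card (parcs ?G `` {u}) = 2 * n" if "u \<in> pverts ?G" for u
    using card_nbhd_lee_graph that assms(2) by simp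
  \<comment> \<open>The all-zero word serves as a vertex at which to apply the degree bound.\<close>
  have "replicate n 0 \<in> pverts ?G"
    using assms by (auto simp: pverts_lee_graph)
  then have lower: "Suc (2 * n) \<le> ?k" and ne: "pverts ?G \<noteq> {}"
    using distance_2_coloring_card_le[OF c] deg by (metis, blast)
  \<comment> \<open>Used in contrapositive form: without the eigenvalue -1, equality in the lower
    bound is impossible, which gains one color.\<close>
  have "adjacency_eigenvalue ?G (-1)" if "?k = Suc (2 * n)"
    using distance_2_coloring_perfect_imp_eigenvalue[OF c(1), of "2 * n"] c(2) deg ne that assms(1)
    by simp
  then have "2 * n + 2 \<le> ?k" if "\<not> adjacency_eigenvalue ?G (-1)"
    using lower that by fastforce
  moreover have "2 * n + 3 \<le> ?k" if "n = 1" "q = 5"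
  proof -
    \<comment> \<open>All five vertices need different colors, and 5 is \<open>2 * n + 3\<close> for
      \<open>n = 1\<close>.\<close>
    have "card (pverts ?G) \<le> card {..<?k}"
      using distance_2_coloring_lee_graph_1_5 c that by (intro card_inj_on_le[of c]) auto
    moreover have "card (pverts ?G) = 5"
      using card_lists_length_eq[of "{..<5::nat}" 1] that
      by (simp add: pverts_lee_graph conj_commute)
    ultimately show ?thesis
      using that by simp
  qed
  ultimately show ?thesis
    using lower by simp
qed

end
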